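(* Let $G$ be a bounded abelian group and $\tau$ a locally quasi-convex group topology on $G$. (i) If $\tau$ is metrizable, then $\tau$ is Mackey. (ii) If $|(G,\tau)^\wedge|<\mathfrak{c}$, then $\tau$ is precompact and Mackey.
   Context: $\mathfrak{c}$ is the cardinality of the continuum. $\mathbb{T}$ is the unit circle group in $\mathbb{C}$ and $\mathbb{T}_+=\{z\in\mathbb{T}:\mathrm{Re}(z)\ge 0\}$. An abelian group $G$ is bounded if there is a positive integer $m$ with $mG=\{0\}$. For a topological abelian group $(G,\tau)$, the dual group $(G,\tau)^\wedge$ is the group of all continuous homomorphisms $(G,\tau)\to\mathbb{T}$. A subset $M\subseteq G$ is quasi-convex if for every $x\in G\setminus M$ there is $\phi\in (G,\tau)^\wedge$ with $\phi(M)\subseteq\mathbb{T}_+$ and $\phi(x)\notin\mathbb{T}_+$. The topology $\tau$ is locally quasi-convex if it has a basis of neighborhoods of $0$ consisting of quasi-convex sets; locally quasi-convex group topologies are taken to be Hausdorff. Two group topologies $\tau,\nu$ on $G$ are compatible if $(G,\tau)^\wedge=(G,\nu)^\wedge$. A locally quasi-convex group topology $\tau$ on $G$ is Mackey if $\nu\le\tau$ (that is, $\nu\subseteq\tau$) for every locally quasi-convex group topology $\nu$ on $G$ compatible with $\tau$. A group topology is precompact if for every neighborhood $U$ of $0$ there is a finite $F\subseteq G$ with $F+U=G$. *)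

theory Defs
  imports "HOL-Analysis.Analysis"
begin

text \<open>A topological abelian group is a type of class \<open>ab_group_add\<close> together with a value
  of type \<open>'a topology\<close> whose underlying set is the whole type, so that several group topologies
  on the same group can be compared.\<close>

definition bounded_group :: "'a::ab_group_add itself \<Rightarrow> bool" where
  "bounded_group _ \<longleftrightarrow> (\<exists>m::nat. m > 0 \<and> range (\<lambda>x::'a. \<Sum>i<m. x) = {0})"

definition group_topology :: "'a::ab_group_add topology \<Rightarrow> bool" where
  "group_topology T \<longleftrightarrow> topspace T = UNIV \<and>
     continuous_map (prod_topology T T) T (\<lambda>(x, y). x + y) \<and>
     continuous_map T T uminus"

definition circle_plus :: "complex set" where
  "circle_plus = {z \<in> sphere 0 1. Re z \<ge> 0}"

definition dual_group :: "'a::ab_group_add topology \<Rightarrow> ('a \<Rightarrow> complex) set" where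
  "dual_group T = {\<phi>. continuous_map T (top_of_set (sphere 0 1)) \<phi> \<and>
                      (\<forall>x y. \<phi> (x + y) = \<phi> x * \<phi> y)}"

definition quasi_convex :: "'a::ab_group_add topology \<Rightarrow> 'a set \<Rightarrow> bool" where
  "quasi_convex T M \<longleftrightarrow>
     (\<forall>x. x \<notin> M \<longrightarrow> (\<exists>\<phi>\<in>dual_group T. \<phi> ` M \<subseteq> circle_plus \<and> \<phi> x \<notin> circle_plus))"

text \<open>Neighbourhoods need not be open; \<^const>\<open>neighbourhood_base_at\<close> follows the same
  convention. The Hausdorff axiom is part of local quasi-convexity.\<close>

definition locally_quasi_convex :: "'a::ab_group_add topology \<Rightarrow> bool" where
  "locally_quasi_convex T \<longleftrightarrow>
     group_topology T \<and> Hausdorff_space T \<and> neighbourhood_base_at 0 (quasi_convex T) T"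

definition compatible :: "'a::ab_group_add topology \<Rightarrow> 'a topology \<Rightarrow> bool" where
  "compatible S T \<longleftrightarrow> group_topology S \<and> group_topology T \<and> dual_group S = dual_group T"

definition mackey :: "'a::ab_group_add topology \<Rightarrow> bool" where
  "mackey T \<longleftrightarrow> locally_quasi_convex T \<and>
     (\<forall>S. locally_quasi_convex S \<and> compatible S T \<longrightarrow> (\<forall>U. openin S U \<longrightarrow> openin T U))"

definition precompact :: "'a::ab_group_add topology \<Rightarrow> bool" where
  "precompact T \<longleftrightarrow> group_topology T \<and>
     (\<forall>U. (\<exists>V. openin T V \<and> 0 \<in> V \<and> V \<subseteq> U) \<longrightarrow>
          (\<exists>F. finite F \<and> {f + u |f u. f \<in> F \<and> u \<in> U} = UNIV))"

end

theory Submission imports Defs begin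

text \<open>On a group of exponent \<open>m\<close> characters take values in the \<open>m\<close>-th roots of unity, and
  no nontrivial subgroup of those lies in \<^const>\<open>circle_plus\<close>; hence a locally quasi-convex topology
  has a base at 0 of open subgroups. Let \<open>H\<close> be a subgroup open in a compatible topology, so
  that all characters trivial on \<open>H\<close> are \<open>\<tau>\<close>-continuous. If some \<open>\<tau>\<close>-neighbourhood of 0
  meets only finitely many cosets of \<open>H\<close>, intersecting it with finitely many kernels shows that
  \<open>H\<close> is \<open>\<tau>\<close>-open. Otherwise characters trivial on \<open>H\<close> can be built by successive extension
  to new elements \<open>x\<^sub>n\<close> of prescribed neighbourhoods \<open>V\<^sub>n\<close>, with at least two admissible values at
  each \<open>x\<^sub>n\<close>. This yields continuum many characters, and one that is nontrivial on every
  \<open>V\<^sub>n\<close>; the latter is not continuous if the \<open>V\<^sub>n\<close> form a base at 0.\<close>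

section \<open>Multiples, subgroups and partial characters\<close>

definition nmult :: "nat \<Rightarrow> 'a::ab_group_add \<Rightarrow> 'a" where
  "nmult n x = (\<Sum>i<n. x)"

lemma nmult_0 [simp]: "nmult 0 x = 0"
  and nmult_Suc [simp]: "nmult (Suc n) x = nmult n x + x"
  and nmult_1 [simp]: "nmult (Suc 0) x = x"
  by (simp_all add: nmult_def)

lemma nmult_add: "nmult (i + j) x = nmult i x + nmult j x"
  by (induction j) (simp_all add: algebra_simps)

lemma nmult_mult: "nmult (i * j) x = nmult i (nmult j x)"
  by (induction i) (simp_all add: nmult_add algebra_simps)

definition exponent_bound :: "'a::ab_group_add itself \<Rightarrow> nat \<Rightarrow> bool" where
  "exponent_bound _ m \<longleftrightarrow> m > 0 \<and> (\<forall>x::'a. nmult m x = 0)"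

lemma bounded_group_exponent:
  assumes "bounded_group TYPE('a::ab_group_add)"
  obtains m where "exponent_bound TYPE('a) m"
  using assms unfolding bounded_group_def exponent_bound_def nmult_def by blast

definition add_subgroup :: "'a::ab_group_add set \<Rightarrow> bool" where
  "add_subgroup H \<longleftrightarrow> 0 \<in> H \<and> (\<forall>x\<in>H. \<forall>y\<in>H. x - y \<in> H)"

lemma add_subgroup_uminus: "add_subgroup H \<Longrightarrow> x \<in> H \<Longrightarrow> - x \<in> H"
  unfolding add_subgroup_def by (metis diff_0)

lemma add_subgroup_add: "add_subgroup H \<Longrightarrow> x \<in> H \<Longrightarrow> y \<in> H \<Longrightarrow> x + y \<in> H"
  using add_subgroup_uminus[of H y] unfolding add_subgroup_def by (metis diff_minus_eq_add)

definition character :: "('a::ab_group_add \<Rightarrow> complex) \<Rightarrow> bool" where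
  "character \<phi> \<longleftrightarrow> (\<forall>x. norm (\<phi> x) = 1) \<and> (\<forall>x y. \<phi> (x + y) = \<phi> x * \<phi> y)"

lemma character_0: "character \<phi> \<Longrightarrow> \<phi> 0 = 1"
  unfolding character_def by (metis add.right_neutral mult_cancel_left2 norm_zero zero_neq_one)

lemma character_nmult: "character \<phi> \<Longrightarrow> \<phi> (nmult n x) = \<phi> x ^ n"
  by (induction n) (simp_all add: character_0, simp add: character_def)

lemma character_power_exponent:
  "exponent_bound TYPE('a::ab_group_add) m \<Longrightarrow> character (\<phi> :: 'a \<Rightarrow> complex) \<Longrightarrow> \<phi> x ^ m = 1"
  by (metis character_nmult character_0 exponent_bound_def)

lemma character_diff_eq_1: 
  assumes "character \<phi>"
  shows "\<phi> (x - y) = 1 \<longleftrightarrow> \<phi> x = \<phi> y"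
proof -
  have "\<phi> x = \<phi> (x - y) * \<phi> y"
    using assms unfolding character_def by (metis diff_add_cancel)
  moreover have "\<phi> y \<noteq> 0"
    using assms unfolding character_def by (metis norm_zero zero_neq_one)
  ultimately show ?thesis by auto
qed

text \<open>A partial character is represented by its graph, a subgroup of the product with the circle.
  Over a bounded group, closure under inverses and values of modulus 1 are automatic.\<close>

definition partial_character :: "('a::ab_group_add \<times> complex) set \<Rightarrow> bool" where
  "partial_character R \<longleftrightarrow> (0, 1) \<in> R \<and> (\<forall>z. (0, z) \<in> R \<longrightarrow> z = 1) \<and>
     (\<forall>x y z w. (x, z) \<in> R \<longrightarrow> (y, w) \<in> R \<longrightarrow> (x + y, z * w) \<in> R)"

text \<open>The graph generated by \<open>R\<close> and the pair \<open>(x, c)\<close>. Natural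
  multiples are enough over a bounded group, where \<open>- x\<close> is itself a multiple of
  \<open>x\<close>.\<close>

definition adjoin :: "('a::ab_group_add \<times> complex) set \<Rightarrow> 'a \<Rightarrow> complex \<Rightarrow> ('a \<times> complex) set" where
  "adjoin R x c = {(b + nmult j x, z * c ^ j) | b z j. (b, z) \<in> R}"

lemma adjoin_superset: "R \<subseteq> adjoin R x c"
proof safe
  fix b z assume "(b, z) \<in> R"
  then have "(b + nmult 0 x, z * c ^ 0) \<in> adjoin R x c"
    unfolding adjoin_def by blast
  then show "(b, z) \<in> adjoin R x c" by simp
qed

lemma adjoin_self:
  assumes "partial_character R"
  shows "(x, c) \<in> adjoin R x c"
proof -
  have "(0 + nmult (Suc 0) x, 1 * c ^ (Suc 0)) \<in> adjoin R x c"
    using assms unfolding adjoin_def partial_character_def by blast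
  then show ?thesis by simp
qed

lemma partial_character_add:
  "partial_character R \<Longrightarrow> (x, z) \<in> R \<Longrightarrow> (y, w) \<in> R \<Longrightarrow> (x + y, z * w) \<in> R"
  by (simp add: partial_character_def)

lemma partial_character_nmult:
  assumes "partial_character R" "(x, z) \<in> R"
  shows "(nmult j x, z ^ j) \<in> R"
proof (induction j)
  case 0
  then show ?case using assms by (simp add: partial_character_def)
next
  case (Suc j)
  then have "(nmult j x + x, z ^ j * z) \<in> R"
    using assms by (simp add: partial_character_def)
  then show ?case by (simp add: mult.commute)
qed

lemma partial_character_power_exponent:
  assumes "exponent_bound TYPE('a::ab_group_add) m"
    and "partial_character (R :: ('a \<times> complex) set)" "(x, z) \<in> R"
  shows "z ^ m = 1"
proof -
  have "(nmult m x, z ^ m) \<in> R" by (rule partial_character_nmult[OF assms(2,3)])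
  then show ?thesis using assms by (simp add: exponent_bound_def partial_character_def)
qed

lemma nmult_inverse:
  assumes "exponent_bound TYPE('a) m"
  shows "nmult (m - 1) x = - (x :: 'a::ab_group_add)"
proof -
  have "nmult (Suc (m - 1)) x = 0"
    using assms by (simp add: exponent_bound_def del: nmult_Suc)
  then show ?thesis by (simp add: eq_neg_iff_add_eq_0)
qed

lemma partial_character_domain:
  assumes m: "exponent_bound TYPE('a::ab_group_add) m"
    and R: "partial_character (R :: ('a \<times> complex) set)"
  shows "add_subgroup (Domain R)"
  unfolding add_subgroup_def
proof (intro conjI ballI)
  show "0 \<in> Domain R" using R by (auto simp: partial_character_def)
  fix x y assume "x \<in> Domain R" "y \<in> Domain R"
  then obtain z w where zw: "(x, z) \<in> R" "(y, w) \<in> R" by auto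
  then have "(nmult (m - 1) y, w ^ (m - 1)) \<in> R"
    using R partial_character_nmult by blast
  then have "(x + - y, z * w ^ (m - 1)) \<in> R"
    using partial_character_add[OF R zw(1)] by (simp only: nmult_inverse[OF m])
  then show "x - y \<in> Domain R" by auto
qed

text \<open>Subtracting \<open>(x, w)\<close> from \<open>(x, z)\<close>, as adding its
  \<open>m - 1\<close>-fold multiple, gives a pair over 0, so its value is 1. This is why triviality
  over 0 alone makes the relation single-valued.\<close>

lemma partial_character_unique:
  assumes m: "exponent_bound TYPE('a::ab_group_add) m"
    and R: "partial_character (R :: ('a \<times> complex) set)" and zw: "(x, z) \<in> R" "(x, w) \<in> R"
  shows "z = w"
proof -
  have "(nmult (m - 1) x, w ^ (m - 1)) \<in> R"
    using zw R partial_character_nmult by blast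
  then have "(x + - x, z * w ^ (m - 1)) \<in> R"
    using partial_character_add[OF R zw(1)] by (simp only: nmult_inverse[OF m])
  then have 1: "z * w ^ (m - 1) = 1" using R by (simp add: partial_character_def)
  have 2: "w * w ^ (m - 1) = 1"
    using partial_character_power_exponent[OF m R zw(2)] m
    by (metis exponent_bound_def power_minus_mult mult.commute)
  show ?thesis using 1 2 by (metis mult.assoc mult.commute mult_1)
qed

lemma partial_character_Union:
  assumes "subset.chain {R. partial_character R} C" "C \<noteq> {}"
  shows "partial_character (\<Union>C)"
  unfolding partial_character_def
proof (intro conjI allI impI)
  have C: "\<And>R. R \<in> C \<Longrightarrow> partial_character R"
    using assms by (auto simp: subset_chain_def)
  show "(0, 1) \<in> \<Union>C" using assms(2) C by (auto simp: partial_character_def)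
  show "z = 1" if "(0, z) \<in> \<Union>C" for z using that C by (auto simp: partial_character_def)
  fix x y z w assume "(x, z) \<in> \<Union>C" "(y, w) \<in> \<Union>C"
  then obtain R S where RS: "R \<in> C" "S \<in> C" "(x, z) \<in> R" "(y, w) \<in> S" by auto
  then have "R \<subseteq> S \<or> S \<subseteq> R" using assms(1) by (auto simp: subset_chain_def)
  then show "(x + y, z * w) \<in> \<Union>C"
    using RS C unfolding partial_character_def by blast
qed

section \<open>Extension of characters\<close>

text \<open>Here \<open>k\<close> is the order of \<open>x\<close> modulo the domain, and
  \<open>c\<close> must be a \<open>k\<close>-th root of the value already fixed at
  \<open>nmult k x\<close>. The only delicate point is the value over 0.\<close>

lemma adjoin_partial_character:
  assumes m: "exponent_bound TYPE('a::ab_group_add) m"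
    and R: "partial_character (R :: ('a \<times> complex) set)"
    and k: "k > 0" "(nmult k x, c ^ k) \<in> R"
    and min: "\<And>j. 0 < j \<Longrightarrow> j < k \<Longrightarrow> nmult j x \<notin> Domain R"
  shows "partial_character (adjoin R x c)"
  unfolding partial_character_def
proof (intro conjI allI impI)
  show "(0, 1) \<in> adjoin R x c"
    using adjoin_superset R by (auto simp: partial_character_def)
next
  fix a b z w assume "(a, z) \<in> adjoin R x c" "(b, w) \<in> adjoin R x c"
  then obtain a' z' i b' w' j where
    "a = a' + nmult i x" "z = z' * c ^ i" "(a', z') \<in> R"
    "b = b' + nmult j x" "w = w' * c ^ j" "(b', w') \<in> R"
    unfolding adjoin_def by blast
  then have "(a' + b', z' * w') \<in> R" "a + b = (a' + b') + nmult (i + j) x"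
      "z * w = (z' * w') * c ^ (i + j)"
    using R by (auto simp: partial_character_def nmult_add power_add)
  then show "(a + b, z * w) \<in> adjoin R x c"
    unfolding adjoin_def by blast
next
  fix w assume "(0, w) \<in> adjoin R x c"
  then obtain b z j where b: "b + nmult j x = 0" "w = z * c ^ j" "(b, z) \<in> R"
    unfolding adjoin_def by auto
  \<comment> \<open>Division by \<open>k\<close> moves the part \<open>q * k\<close> of the multiple
    into \<open>R\<close>; the remainder then lies in the domain and vanishes by minimality of
    \<open>k\<close>.\<close>
  define q r where "q = j div k" and "r = j mod k"
  have j: "j = r + q * k" by (simp add: q_def r_def)
  have qk: "(nmult (q * k) x, (c ^ k) ^ q) \<in> R"
    using partial_character_nmult[OF R k(2), of q] by (simp add: nmult_mult)
  then have sum: "(b + nmult (q * k) x, z * (c ^ k) ^ q) \<in> R"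
    using b(3) R by (simp add: partial_character_def)
  have "nmult r x = - (b + nmult (q * k) x)"
    using b(1) unfolding j nmult_add by (simp add: eq_neg_iff_add_eq_0 algebra_simps)
  then have "nmult r x \<in> Domain R"
    using add_subgroup_uminus[OF partial_character_domain[OF m R] DomainI[OF sum]] by (simp only:)
  moreover have "r < k" using k(1) by (simp add: r_def)
  ultimately have "r = 0" using min by blast
  then have "(0, w) \<in> R" using sum b by (simp add: j power_mult mult.commute[of q])
  then show "w = 1" using R by (simp add: partial_character_def)
qed

text \<open>The admissible values at \<open>x\<close> include all \<open>k\<close>-th roots of the
  nonzero value \<open>w\<close> at \<open>nmult k x\<close>. Since \<open>x\<close> lies outside
  the domain, \<open>k\<close> is at least 2, so there are two of them.\<close>

lemma partial_character_extend:
  assumes m: "exponent_bound TYPE('a::ab_group_add) m"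
    and R: "partial_character (R :: ('a \<times> complex) set)" and x: "x \<notin> Domain R"
  obtains c d where "c \<noteq> d" "d \<noteq> 1"
    "partial_character (adjoin R x c)" "partial_character (adjoin R x d)"
proof -
  define k where "k = (LEAST k. k > 0 \<and> nmult k x \<in> Domain R)"
  have "m > 0 \<and> nmult m x \<in> Domain R"
    using m R by (auto simp: exponent_bound_def partial_character_def)
  then have k: "k > 0" "nmult k x \<in> Domain R"
    unfolding k_def by (metis (mono_tags, lifting) LeastI)+
  have min: "nmult j x \<notin> Domain R" if "0 < j" "j < k" for j
    using that not_less_Least unfolding k_def by blast
  obtain w where w: "(nmult k x, w) \<in> R" using k by auto
  have "k \<noteq> 1" using k x by auto
  with k have "k \<ge> 2" by auto
  have "w \<noteq> 0"
    using partial_character_power_exponent[OF m R w] m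
    by (auto simp: exponent_bound_def power_0_left)
  then have "card {z. z ^ k = w} \<ge> 2"
    using card_nth_roots k(1) \<open>k \<ge> 2\<close> by simp
  then obtain c d where cd: "c ^ k = w" "d ^ k = w" "c \<noteq> d"
    by (force simp: card_le_Suc_iff numeral_2_eq_2)
  have "partial_character (adjoin R x e)" if "e ^ k = w" for e
    using adjoin_partial_character[OF m R k(1) _ min] that w by blast
  \<comment> \<open>At most one of the two roots is 1, so they can be named such that
    \<open>d\<close> is not.\<close>
  then show ?thesis
    using cd that by metis
qed

text \<open>Zorn's lemma gives a maximal extension; it is total because any missing element could
  still be adjoined.\<close>

lemma partial_character_total:
  assumes m: "exponent_bound TYPE('a::ab_group_add) m"
    and R: "partial_character (R :: ('a \<times> complex) set)"
  obtains \<phi> where "character \<phi>" "\<And>x z. (x, z) \<in> R \<Longrightarrow> \<phi> x = z"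
proof -
  let ?A = "{S. partial_character S \<and> R \<subseteq> S}"
  have "\<exists>M\<in>?A. \<forall>X\<in>?A. M \<subseteq> X \<longrightarrow> X = M"
  proof (rule subset_Zorn_nonempty)
    show "?A \<noteq> {}" using R by auto
    fix C assume "C \<noteq> {}" and C: "subset.chain ?A C"
    then have "subset.chain {R. partial_character R} C"
      by (auto simp: subset_chain_def)
    then have "partial_character (\<Union>C)"
      using \<open>C \<noteq> {}\<close> by (rule partial_character_Union)
    moreover have "R \<subseteq> \<Union>C"
      using \<open>C \<noteq> {}\<close> C unfolding subset_chain_def by blast
    ultimately show "\<Union>C \<in> ?A" by simp
  qed
  then obtain M where M: "partial_character M" "R \<subseteq> M" and "\<forall>X\<in>?A. M \<subseteq> X \<longrightarrow> X = M"
    by blast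
  then have max: "X = M" if "partial_character X" "M \<subseteq> X" for X
    using that by blast
  have dom: "x \<in> Domain M" for x
  proof (rule ccontr)
    assume x: "x \<notin> Domain M"
    then obtain c where "partial_character (adjoin M x c)"
      using partial_character_extend[OF m M(1)] by metis
    then have "adjoin M x c = M" using max adjoin_superset by blast
    then show False using adjoin_self[OF M(1), of x c] x by auto
  qed
  define \<phi> where "\<phi> x = (SOME z. (x, z) \<in> M)" for x
  have \<phi>: "(x, \<phi> x) \<in> M" for x
    using dom[of x] unfolding \<phi>_def by (metis DomainE someI)
  have eq: "\<phi> x = z" if "(x, z) \<in> M" for x z
    using partial_character_unique[OF m M(1) \<phi> that] .
  \<comment> \<open>The values are \<open>m\<close>-th roots of unity.\<close>
  have "norm (\<phi> x) = 1" for x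
    using partial_character_power_exponent[OF m M(1) \<phi>] m
    by (metis exponent_bound_def power_eq_1_iff less_irrefl)
  moreover have "\<phi> (x + y) = \<phi> x * \<phi> y" for x y
    using M(1) \<phi> by (intro eq) (auto simp: partial_character_def)
  ultimately have "character \<phi>" by (simp add: character_def)
  then show ?thesis using that eq M(2) by blast
qed

lemma partial_character_trivial:
  "add_subgroup H \<Longrightarrow> partial_character (H \<times> {1})"
  by (auto simp: partial_character_def add_subgroup_add) (simp add: add_subgroup_def)

text \<open>The trivial character of \<open>H\<close> is extended to \<open>x\<close> by a value
  other than 1, and then to the whole group.\<close>

lemma character_separates:
  assumes m: "exponent_bound TYPE('a::ab_group_add) m"
    and H: "add_subgroup H" and x: "(x::'a) \<notin> H"
  obtains \<phi> where "character \<phi>" "\<And>h. h \<in> H \<Longrightarrow> \<phi> h = 1" "\<phi> x \<noteq> 1"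
proof -
  note triv = partial_character_trivial[OF H]
  have "x \<notin> Domain (H \<times> {1::complex})" using x by auto
  then obtain d where d: "d \<noteq> 1" "partial_character (adjoin (H \<times> {1}) x d)"
    using partial_character_extend[OF m triv] by metis
  obtain \<phi> where \<phi>: "character \<phi>" "\<And>y z. (y, z) \<in> adjoin (H \<times> {1}) x d \<Longrightarrow> \<phi> y = z"
    using partial_character_total[OF m d(2)] by metis
  have "\<phi> h = 1" if "h \<in> H" for h
    using \<phi>(2)[of h 1] adjoin_superset[of "H \<times> {1}" x d] that by auto
  moreover have "\<phi> x \<noteq> 1" using \<phi>(2)[OF adjoin_self[OF triv]] d(1) by simp
  ultimately show ?thesis using that \<phi>(1) by blast
qed

section \<open>Finite coset covers and large families of characters\<close>

text \<open>For a subgroup \<open>H\<close>, this says that \<open>W\<close> has finite image in the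
  quotient by \<open>H\<close>, without forming that quotient.\<close>

definition finitely_covered :: "'a::ab_group_add set \<Rightarrow> 'a set \<Rightarrow> bool" where
  "finitely_covered H W \<longleftrightarrow> (\<exists>E. finite E \<and> (\<forall>x\<in>W. \<exists>e\<in>E. x - e \<in> H))"

lemma finitely_covered_subset: "finitely_covered H W \<Longrightarrow> V \<subseteq> W \<Longrightarrow> finitely_covered H V"
  unfolding finitely_covered_def by blast

lemma nmult_mod_exponent:
  assumes "exponent_bound TYPE('a::ab_group_add) m"
  shows "nmult (j mod m) (x::'a) = nmult j x"
proof -
  have "nmult (j div m * m + j mod m) x = nmult (j mod m) x"
    unfolding nmult_add nmult_mult using assms
    by (simp add: exponent_bound_def) (simp add: nmult_def)
  then show ?thesis by simp
qed

lemma finitely_covered_adjoin: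
  assumes m: "exponent_bound TYPE('a::ab_group_add) m"
    and "finitely_covered H (Domain (R :: ('a \<times> complex) set))"
  shows "finitely_covered H (Domain (adjoin R x c))"
proof -
  obtain E where E: "finite E" "\<And>y. y \<in> Domain R \<Longrightarrow> \<exists>e\<in>E. y - e \<in> H"
    using assms(2) by (auto simp: finitely_covered_def)
  \<comment> \<open>Multiples of \<open>x\<close> depend only on \<open>j mod m\<close>, so
    \<open>m\<close> translates of \<open>E\<close> cover the new domain.\<close>
  let ?E = "(\<lambda>(e, j). e + nmult j x) ` (E \<times> {..<m})"
  have "\<exists>e\<in>?E. y - e \<in> H" if y: "y \<in> Domain (adjoin R x c)" for y
  proof -
    obtain b z j where b: "y = b + nmult j x" "(b, z) \<in> R"
      using y unfolding adjoin_def by blast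
    then obtain e where e: "e \<in> E" "b - e \<in> H" using E(2) by blast
    have "j mod m < m" using m by (simp add: exponent_bound_def)
    then have "e + nmult (j mod m) x \<in> ?E" using e(1) by force
    moreover have "y - (e + nmult (j mod m) x) = b - e"
      by (simp add: b(1) nmult_mod_exponent[OF m])
    ultimately show ?thesis using e(2) by metis
  qed
  moreover have "finite ?E" using E(1) by blast
  ultimately show ?thesis unfolding finitely_covered_def by blast
qed

text \<open>A binary tree of partial characters starts at the trivial one on \<open>H\<close>; level
  \<open>n\<close> adjoins a new point of \<open>V n\<close> with one of two values, and
  \<open>s\<close> selects the branch.\<close>

lemma many_characters:
  assumes m: "exponent_bound TYPE('a::ab_group_add) m"
    and H: "add_subgroup (H :: 'a set)"
    and V: "\<And>n::nat. \<not> finitely_covered H (V n)"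
  obtains \<Phi> :: "nat set \<Rightarrow> 'a::ab_group_add \<Rightarrow> complex" where "inj \<Phi>" "\<And>s. character (\<Phi> s)"
    "\<And>s h. h \<in> H \<Longrightarrow> \<Phi> s h = 1" "\<And>n. \<exists>x\<in>V n. \<Phi> UNIV x \<noteq> 1"
proof -
  \<comment> \<open>The second conjunct guarantees that no \<open>V n\<close> is exhausted by the
    domain, so the construction never stops.\<close>
  define good where "good R \<longleftrightarrow> partial_character R \<and> finitely_covered H (Domain R)"
    for R :: "('a \<times> complex) set"
  have "\<exists>x c d. x \<in> V n \<and> c \<noteq> d \<and> d \<noteq> 1 \<and> good (adjoin R x c) \<and> good (adjoin R x d)"
    if R: "good R" for n R
  proof -
    have "\<not> V n \<subseteq> Domain R" using V R finitely_covered_subset by (metis good_def)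
    then obtain x where x: "x \<in> V n" "x \<notin> Domain R" by auto
    obtain c d where "c \<noteq> d" "d \<noteq> 1"
      "partial_character (adjoin R x c)" "partial_character (adjoin R x d)"
      using partial_character_extend[OF m _ x(2)] R by (metis good_def)
    then show ?thesis
      using x R finitely_covered_adjoin[OF m] unfolding good_def by blast
  qed
  then have "\<forall>n R. \<exists>x c d. good R \<longrightarrow> x \<in> V n \<and> c \<noteq> d \<and> d \<noteq> 1 \<and>
      good (adjoin R x c) \<and> good (adjoin R x d)"
    by blast
  then obtain X C D where XCD: "\<And>n R. good R \<Longrightarrow> X n R \<in> V n \<and> C n R \<noteq> D n R \<and> D n R \<noteq> 1 \<and>
      good (adjoin R (X n R) (C n R)) \<and> good (adjoin R (X n R) (D n R))"
    unfolding choice_iff by blast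
  \<comment> \<open>Membership of \<open>n\<close> in \<open>s\<close> selects \<open>D\<close>,
    which is never 1; thus the branch \<open>UNIV\<close> is nontrivial at every chosen
    point.\<close>
  define next_value where "next_value s n R = (if n \<in> s then D n R else C n R)" for s n R
  define G where
    "G s = rec_nat (H \<times> {1}) (\<lambda>n R. adjoin R (X n R) (next_value s n R))" for s
  have G0: "G s 0 = H \<times> {1}" and
    GSuc: "G s (Suc n) = adjoin (G s n) (X n (G s n)) (next_value s n (G s n))" for s n
    by (simp_all add: G_def)
  have good: "good (G s n)" for s n
  proof (induction n)
    case 0
    have "finitely_covered H H" unfolding finitely_covered_def
      by (intro exI[of _ "{0}"]) auto
    then show ?case
      using partial_character_trivial[OF H] by (simp add: G0 good_def Domain_fst)
  next
    case (Suc n)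
    then show ?case using XCD by (simp add: GSuc next_value_def)
  qed
  have mono: "G s i \<subseteq> G s j" if "i \<le> j" for s i j
    using lift_Suc_mono_le[of "G s"] that GSuc adjoin_superset by metis
  have union: "partial_character (\<Union>(range (G s)))" for s
  proof (rule partial_character_Union)
    have "G s i \<subseteq> G s j \<or> G s j \<subseteq> G s i" for i j
      using mono by (metis nat_le_linear)
    then show "subset.chain {R. partial_character R} (range (G s))"
      using good by (auto simp: subset_chain_def good_def)
  qed auto
  have "\<exists>\<phi>. character \<phi> \<and> (\<forall>x z. (x, z) \<in> \<Union>(range (G s)) \<longrightarrow> \<phi> x = z)" for s
    using partial_character_total[OF m union] by metis
  then obtain \<Phi> where char: "\<And>s. character (\<Phi> s)"
    and \<Phi>: "\<And>s n x z. (x, z) \<in> G s n \<Longrightarrow> \<Phi> s x = z"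
    by (metis UN_I UNIV_I)
  have at_X: "\<Phi> s (X n (G s n)) = next_value s n (G s n)" for s n
    using \<Phi>[of _ _ s "Suc n"] adjoin_self good by (metis GSuc good_def)
  have "inj \<Phi>"
  proof (rule injI, rule ccontr)
    fix s t :: "nat set" assume eq: "\<Phi> s = \<Phi> t" and "s \<noteq> t"
    then have ex: "\<exists>n. (n \<in> s) \<noteq> (n \<in> t)" by blast
    \<comment> \<open>Below the first difference both branches coincide, so at level
      \<open>n\<close> they choose the same point but give it the distinct values \<open>C\<close>
      and \<open>D\<close>.\<close>
    define n where "n = (LEAST n. (n \<in> s) \<noteq> (n \<in> t))"
    have n: "(n \<in> s) \<noteq> (n \<in> t)" unfolding n_def using LeastI_ex[OF ex] .
    have below: "(i \<in> s) = (i \<in> t)" if "i < n" for i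
      using not_less_Least that unfolding n_def by blast
    have "G s i = G t i" if "i \<le> n" for i
      using that by (induction i) (auto simp: G0 GSuc next_value_def below)
    then have "next_value s n (G s n) = next_value t n (G s n)"
      using at_X[of s n] at_X[of t n] eq by simp
    moreover have "C n (G s n) \<noteq> D n (G s n)" using XCD good by blast
    ultimately show False using n by (auto simp: next_value_def split: if_splits)
  qed
  moreover have "\<Phi> s h = 1" if "h \<in> H" for s h
    using \<Phi>[of h 1 s 0] that by (simp add: G0)
  moreover have "\<exists>x\<in>V n. \<Phi> UNIV x \<noteq> 1" for n
    using at_X[of UNIV n] XCD[OF good, of n UNIV n] unfolding next_value_def by (metis UNIV_I)
  ultimately show ?thesis using that char by blast
qed

section \<open>Group topologies on bounded groups\<close>

lemma group_topology_openin_translate: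
  assumes T: "group_topology T" and U: "openin T U"
  shows "openin T {y. a + y \<in> U}"
proof -
  have top: "topspace T = UNIV" using T by (simp add: group_topology_def)
  have "continuous_map T (prod_topology T T) (\<lambda>y. (a, y))"
    by (simp add: continuous_map_pairwise o_def top)
  then have "continuous_map T T ((\<lambda>(x, y). x + y) \<circ> (\<lambda>y. (a, y)))"
    using T unfolding group_topology_def by (meson continuous_map_compose)
  then have "openin T {y \<in> topspace T. ((\<lambda>(x, y). x + y) \<circ> (\<lambda>y. (a, y))) y \<in> U}"
    using U openin_continuous_map_preimage by blast
  then show ?thesis by (simp add: top)
qed

lemma continuous_map_nmult:
  assumes T: "group_topology T"
  shows "continuous_map T T (nmult j)"
proof (induction j)
  case 0
  then show ?case using T by (simp add: group_topology_def)
next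
  case (Suc j)
  then have "continuous_map T (prod_topology T T) (\<lambda>y. (nmult j y, y))"
    by (simp add: continuous_map_pairwise o_def)
  then have "continuous_map T T ((\<lambda>(x, y). x + y) \<circ> (\<lambda>y. (nmult j y, y)))"
    using T unfolding group_topology_def by (meson continuous_map_compose)
  then show ?case by (simp add: o_def)
qed

lemma subgroup_openin:
  assumes T: "group_topology T" and H: "add_subgroup H"
    and W: "openin T W" "0 \<in> W" "W \<subseteq> H"
  shows "openin T H"
proof (subst openin_subopen, intro ballI)
  fix x assume x: "x \<in> H"
  let ?N = "{y. - x + y \<in> W}"
  have "openin T ?N" by (rule group_topology_openin_translate[OF T W(1)])
  moreover have "x \<in> ?N" using W by simp
  moreover have "?N \<subseteq> H"
  proof
    fix y assume "y \<in> ?N"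
    then have "x + (- x + y) \<in> H" using W x add_subgroup_add[OF H] by blast
    then show "y \<in> H" by simp
  qed
  ultimately show "\<exists>T'. openin T T' \<and> x \<in> T' \<and> T' \<subseteq> H" by blast
qed

lemma dual_group_character: "group_topology T \<Longrightarrow> \<phi> \<in> dual_group T \<Longrightarrow> character \<phi>"
  by (auto simp: dual_group_def character_def group_topology_def continuous_map_def)

text \<open>Such a character is constant on the cosets of \<open>H\<close> and hence locally
  constant.\<close>

lemma dual_groupI:
  assumes T: "group_topology T" and \<phi>: "character \<phi>"
    and H: "openin T H" "0 \<in> H" "\<And>h. h \<in> H \<Longrightarrow> \<phi> h = 1"
  shows "\<phi> \<in> dual_group T"
proof -
  have "openin T {x \<in> topspace T. \<phi> x \<in> U}" for U
  proof (subst openin_subopen, intro ballI)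
    fix x assume x: "x \<in> {x \<in> topspace T. \<phi> x \<in> U}"
    let ?N = "{y. - x + y \<in> H}"
    have "\<phi> y = \<phi> x" if "y \<in> ?N" for y
      using character_diff_eq_1[OF \<phi>, of y x] H(3)[of "- x + y"] that by simp
    then have "?N \<subseteq> {x \<in> topspace T. \<phi> x \<in> U}"
      using x T by (auto simp: group_topology_def)
    moreover have "openin T ?N" by (rule group_topology_openin_translate[OF T H(1)])
    ultimately show "\<exists>N. openin T N \<and> x \<in> N \<and> N \<subseteq> {x \<in> topspace T. \<phi> x \<in> U}"
      using H(2) by (intro exI[of _ ?N]) simp
  qed
  then show ?thesis
    using \<phi> by (auto simp: dual_group_def character_def continuous_map_def)
qed

lemma dual_group_kernel_openin:
  assumes m: "exponent_bound TYPE('a::ab_group_add) m"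
    and T: "group_topology (T :: 'a topology)" and \<phi>: "\<phi> \<in> dual_group T"
  shows "openin T {x. \<phi> x = 1}"
proof -
  have char: "character \<phi>" using dual_group_character T \<phi> by blast
  have top: "topspace T = UNIV" using T by (simp add: group_topology_def)
  \<comment> \<open>The possible values other than 1 form a finite, hence closed, set, so 1 is
    isolated among the values.\<close>
  let ?F = "{z::complex. z ^ m = 1} - {1}"
  have "finite ?F" using m by (auto simp: exponent_bound_def)
  then have "open (- ?F)" by (intro open_Compl finite_imp_closed)
  then have "openin (top_of_set (sphere 0 1)) (sphere 0 1 \<inter> - ?F)"
    by (rule openin_open_Int)
  then have "openin T {x \<in> topspace T. \<phi> x \<in> sphere 0 1 \<inter> - ?F}"
    using \<phi> openin_continuous_map_preimage by (fastforce simp: dual_group_def)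
  moreover have "{x \<in> topspace T. \<phi> x \<in> sphere 0 1 \<inter> - ?F} = {x. \<phi> x = 1}"
    using character_power_exponent[OF m char] char by (auto simp: top character_def)
  ultimately show ?thesis by simp
qed

section \<open>Open subgroups from quasi-convex neighbourhoods\<close>

text \<open>If \<open>z\<close> is not 1, its powers sum to 0, whereas their real parts are
  nonnegative and the zeroth one is 1.\<close>

lemma root_of_unity_powers_circle_plus:
  assumes "z ^ m = 1" "m > 0" "\<And>j. j < m \<Longrightarrow> z ^ j \<in> circle_plus"
  shows "z = 1"
proof (rule ccontr)
  assume "z \<noteq> 1"
  then have "(\<Sum>j<m. z ^ j) = 0" using assms(1) by (simp add: geometric_sum)
  then have "(\<Sum>j<m. Re (z ^ j)) = 0" by (metis Re_sum zero_complex.sel(1))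
  moreover have "(\<Sum>j<m. Re (z ^ j)) \<ge> Re (z ^ 0)"
    using assms by (intro member_le_sum) (auto simp: circle_plus_def)
  ultimately show False by simp
qed

text \<open>The subgroup is the common kernel of the polar of a quasi-convex \<open>M\<close>. It
  lies in \<open>M\<close>, since a point outside \<open>M\<close> would be moved out of
  \<open>circle_plus\<close> by some member of the polar.\<close>

lemma locally_quasi_convex_linear:
  assumes m: "exponent_bound TYPE('a::ab_group_add) m"
    and T: "locally_quasi_convex (T :: 'a topology)" and U: "openin T U" "0 \<in> U"
  obtains H where "add_subgroup H" "openin T H" "H \<subseteq> U"
proof -
  have gt: "group_topology T" using T by (simp add: locally_quasi_convex_def)
  then have top: "topspace T = UNIV" by (simp add: group_topology_def)
  obtain V M where V: "openin T V" "0 \<in> V" "V \<subseteq> M" "M \<subseteq> U" and M: "quasi_convex T M"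
    using T U unfolding locally_quasi_convex_def neighbourhood_base_at_def by metis
  \<comment> \<open>The polar of \<open>M\<close> among the continuous characters.\<close>
  define P where "P = {\<phi> \<in> dual_group T. \<phi> ` M \<subseteq> circle_plus}"
  have char: "character \<phi>" if "\<phi> \<in> P" for \<phi>
    using that dual_group_character[OF gt] by (simp add: P_def)
  define H where "H = {x. \<forall>\<phi>\<in>P. \<phi> x = 1}"
  have H: "add_subgroup H"
    using char by (auto simp: add_subgroup_def H_def character_0 character_diff_eq_1)
  \<comment> \<open>All multiples of a point of \<open>W\<close> stay in \<open>M\<close>, so each
    \<open>\<phi>\<close> in \<open>P\<close> keeps all powers of its value in
    \<open>circle_plus\<close>, which forces that value to be 1.\<close>
  define W where "W = (\<Inter>j\<in>{..<m}. {x \<in> topspace T. nmult j x \<in> V})"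
  have "openin T W"
    unfolding W_def
    using m V(1) by (intro openin_INT2 openin_continuous_map_preimage[OF continuous_map_nmult[OF gt]])
      (auto simp: exponent_bound_def)
  moreover have "0 \<in> W"
    using V(2) by (auto simp: W_def top nmult_def)
  moreover have "W \<subseteq> H"
  proof
    fix x assume x: "x \<in> W"
    have "\<phi> x = 1" if \<phi>: "\<phi> \<in> P" for \<phi>
    proof (rule root_of_unity_powers_circle_plus)
      show "\<phi> x ^ m = 1" using character_power_exponent[OF m char[OF \<phi>]] .
      show "m > 0" using m by (simp add: exponent_bound_def)
      fix j assume "j < m"
      then have "nmult j x \<in> M" using x V(3) by (auto simp: W_def)
      then have "\<phi> (nmult j x) \<in> circle_plus" using \<phi> by (auto simp: P_def)
      then show "\<phi> x ^ j \<in> circle_plus" using character_nmult[OF char[OF \<phi>]] by simp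
    qed
    then show "x \<in> H" by (simp add: H_def)
  qed
  ultimately have "openin T H" using subgroup_openin[OF gt H] by blast
  moreover have "H \<subseteq> M"
  proof (rule subsetI, rule ccontr)
    fix x assume "x \<in> H" "x \<notin> M"
    then obtain \<phi> where "\<phi> \<in> P" "\<phi> x \<notin> circle_plus"
      using M unfolding quasi_convex_def P_def by blast
    then show False using \<open>x \<in> H\<close> by (auto simp: H_def circle_plus_def)
  qed
  ultimately show ?thesis using that H V(4) by blast
qed

section \<open>A criterion for Mackey topologies\<close>

lemma finitely_covered_subgroup_openin:
  assumes m: "exponent_bound TYPE('a::ab_group_add) m"
    and T: "group_topology (T :: 'a topology)" and H: "add_subgroup H"
    and dual: "\<And>\<phi>. character \<phi> \<Longrightarrow> (\<And>h. h \<in> H \<Longrightarrow> \<phi> h = 1) \<Longrightarrow> \<phi> \<in> dual_group T"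
    and W: "openin T W" "0 \<in> W" "finitely_covered H W"
  shows "openin T H"
proof -
  obtain E where E: "finite E" "\<And>x. x \<in> W \<Longrightarrow> \<exists>e\<in>E. x - e \<in> H"
    using W(3) by (auto simp: finitely_covered_def)
  have "\<exists>\<phi>. character \<phi> \<and> (\<forall>h\<in>H. \<phi> h = 1) \<and> \<phi> e \<noteq> 1" if "e \<notin> H" for e
    using character_separates[OF m H that] by metis
  then obtain \<phi> where \<phi>: "\<And>e. e \<notin> H \<Longrightarrow> character (\<phi> e)"
    "\<And>e h. e \<notin> H \<Longrightarrow> h \<in> H \<Longrightarrow> \<phi> e h = 1" "\<And>e. e \<notin> H \<Longrightarrow> \<phi> e e \<noteq> 1"
    by metis
  \<comment> \<open>\<open>K\<close> removes from \<open>W\<close> every coset of a representative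
    \<open>e\<close> outside \<open>H\<close>: there \<open>\<phi> e\<close> has the constant value
    \<open>\<phi> e e\<close>, which is not 1.\<close>
  define K where "K = W \<inter> (\<Inter>e\<in>E - H. {x. \<phi> e x = 1})"
  have ker: "openin T {x. \<phi> e x = 1}" if "e \<in> E - H" for e
    using that dual[of "\<phi> e"] \<phi>(1,2)[of e] dual_group_kernel_openin[OF m T] by blast
  have "openin T K"
  \<comment> \<open>\<open>openin_INT2\<close> requires a nonempty index set.\<close>
  proof (cases "E - H = {}")
    case True
    then show ?thesis using W(1) unfolding K_def by (metis INT_empty Int_UNIV_right)
  next
    case False
    then show ?thesis
      unfolding K_def using E(1) W(1) ker by (intro openin_Int openin_INT2) auto
  qed
  moreover have "0 \<in> K" using W(2) \<phi>(1) character_0 by (auto simp: K_def)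
  moreover have "K \<subseteq> H"
  proof
    fix x assume x: "x \<in> K"
    then obtain e where e: "e \<in> E" "x - e \<in> H" using E(2) by (auto simp: K_def)
    have "e \<in> H"
    proof (rule ccontr)
      assume "e \<notin> H"
      then have "\<phi> e x = 1" "\<phi> e (x - e) = 1" "character (\<phi> e)" "\<phi> e e \<noteq> 1"
        using x e \<phi> by (auto simp: K_def)
      then show False using character_diff_eq_1 by metis
    qed
    then show "x \<in> H" using add_subgroup_add[OF H e(2), of e] by simp
  qed
  ultimately show ?thesis using subgroup_openin[OF T H] by blast
qed

text \<open>Neighbourhoods of 0 in a compatible \<open>S\<close> contain \<open>S\<close>-open
  subgroups \<open>H\<close>. The cover provided by \<open>step\<close> makes each such
  \<open>H\<close> open in \<open>T\<close>, and its translates then show that \<open>S\<close>-open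
  sets are \<open>T\<close>-open.\<close>

lemma mackeyI:
  assumes m: "exponent_bound TYPE('a::ab_group_add) m"
    and T: "locally_quasi_convex (T :: 'a topology)"
    and step: "\<And>H. add_subgroup H \<Longrightarrow>
      (\<And>\<phi>. character \<phi> \<Longrightarrow> (\<And>h. h \<in> H \<Longrightarrow> \<phi> h = 1) \<Longrightarrow> \<phi> \<in> dual_group T) \<Longrightarrow>
      \<exists>W. openin T W \<and> 0 \<in> W \<and> finitely_covered H W"
  shows "mackey T"
  unfolding mackey_def
proof (intro conjI allI impI T)
  fix S :: "'a topology" and U
  assume "locally_quasi_convex S \<and> compatible S T" and U: "openin S U"
  then have S: "locally_quasi_convex S" and gS: "group_topology S" and gT: "group_topology T"
    and dual: "dual_group S = dual_group T"
    by (auto simp: compatible_def)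
  show "openin T U"
  proof (subst openin_subopen, intro ballI)
    fix x assume x: "x \<in> U"
    have "openin S {y. x + y \<in> U}" by (rule group_topology_openin_translate[OF gS U])
    moreover have "0 \<in> {y. x + y \<in> U}" using x by simp
    ultimately obtain H where H: "add_subgroup H" "openin S H" "H \<subseteq> {y. x + y \<in> U}"
      using locally_quasi_convex_linear[OF m S] by metis
    have 0: "0 \<in> H" using H(1) by (simp add: add_subgroup_def)
    \<comment> \<open>A character trivial on the \<open>S\<close>-open \<open>H\<close> is
      \<open>S\<close>-continuous; compatibility transfers this to \<open>T\<close>.\<close>
    have *: "\<phi> \<in> dual_group T" if "character \<phi>" "\<And>h. h \<in> H \<Longrightarrow> \<phi> h = 1" for \<phi>
      using dual_groupI[OF gS _ H(2) 0] that dual by blast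
    obtain W where "openin T W" "0 \<in> W" "finitely_covered H W"
      using step[OF H(1) *] by blast
    then have "openin T H"
      using finitely_covered_subgroup_openin[OF m gT H(1) *] by blast
    then have "openin T {y. - x + y \<in> H}" by (rule group_topology_openin_translate[OF gT])
    moreover have "x \<in> {y. - x + y \<in> H}" using 0 by simp
    moreover have "{y. - x + y \<in> H} \<subseteq> U"
    proof
      fix y assume "y \<in> {y. - x + y \<in> H}"
      then have "x + (- x + y) \<in> U" using H(3) by blast
      then show "y \<in> U" by simp
    qed
    ultimately show "\<exists>N. openin T N \<and> x \<in> N \<and> N \<subseteq> U" by blast
  qed
qed

text \<open>Puts a countable local base into the sequence form that \<open>many_characters\<close>
  takes; members may repeat.\<close>

lemma first_countable_sequence:
  assumes "first_countable T" "x \<in> topspace T"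
  obtains V :: "nat \<Rightarrow> 'a set" where "\<And>n. openin T (V n)" "\<And>n. x \<in> V n"
    "\<And>U. openin T U \<Longrightarrow> x \<in> U \<Longrightarrow> \<exists>n. V n \<subseteq> U"
proof -
  obtain \<B> where \<B>: "countable \<B>" "\<And>V. V \<in> \<B> \<Longrightarrow> openin T V"
    "\<And>U. openin T U \<Longrightarrow> x \<in> U \<Longrightarrow> \<exists>V\<in>\<B>. x \<in> V \<and> V \<subseteq> U"
    using assms unfolding first_countable_def by metis
  let ?B = "{V \<in> \<B>. x \<in> V}"
  have ne: "?B \<noteq> {}" using \<B>(3)[of "topspace T"] assms(2) by auto
  have "countable ?B" using \<B>(1) by simp
  then have range: "range (from_nat_into ?B) = ?B" using range_from_nat_into[OF ne] by blast
  show ?thesis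
  proof (rule that[of "from_nat_into ?B"])
    show "openin T (from_nat_into ?B n)" "x \<in> from_nat_into ?B n" for n
      using from_nat_into[OF ne, of n] \<B>(2) by auto
    show "\<exists>n. from_nat_into ?B n \<subseteq> U" if "openin T U" "x \<in> U" for U
      using \<B>(3)[OF that] range by (metis (mono_tags, lifting) mem_Collect_eq imageE)
  qed
qed

theorem theoremB:
  fixes \<tau> :: "'a::ab_group_add topology"
  assumes "bounded_group TYPE('a)"
    and "locally_quasi_convex \<tau>"
  shows "(metrizable_space \<tau> \<longrightarrow> mackey \<tau>) \<and>
         (dual_group \<tau> \<prec> (UNIV :: real set) \<longrightarrow> precompact \<tau> \<and> mackey \<tau>)"
proof -
  obtain m where m: "exponent_bound TYPE('a) m"
    using bounded_group_exponent[OF assms(1)] .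
  have gt: "group_topology \<tau>" using assms(2) by (simp add: locally_quasi_convex_def)
  then have top: "topspace \<tau> = UNIV" by (simp add: group_topology_def)
  have "mackey \<tau>" if metr: "metrizable_space \<tau>"
  proof (rule mackeyI[OF m assms(2)], rule ccontr)
    fix H :: "'a set"
    assume H: "add_subgroup H"
      and dual: "\<And>\<phi>. character \<phi> \<Longrightarrow> (\<And>h. h \<in> H \<Longrightarrow> \<phi> h = 1) \<Longrightarrow> \<phi> \<in> dual_group \<tau>"
      and no_cover: "\<not> (\<exists>W. openin \<tau> W \<and> 0 \<in> W \<and> finitely_covered H W)"
    obtain V where V: "\<And>n::nat. openin \<tau> (V n)" "\<And>n. 0 \<in> V n"
      "\<And>U. openin \<tau> U \<Longrightarrow> 0 \<in> U \<Longrightarrow> \<exists>n. V n \<subseteq> U"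
      using first_countable_sequence[OF metrizable_imp_first_countable[OF metr], of 0] top
      by (metis UNIV_I)
    then have "\<not> finitely_covered H (V n)" for n using no_cover by blast
    \<comment> \<open>This is the branch \<open>UNIV\<close>. Being trivial on \<open>H\<close> it
      is continuous, so its kernel would have to contain some \<open>V n\<close>.\<close>
    then obtain \<phi> where \<phi>: "character \<phi>" "\<And>h. h \<in> H \<Longrightarrow> \<phi> h = 1" "\<And>n. \<exists>x\<in>V n. \<phi> x \<noteq> 1"
      using many_characters[OF m H] by metis
    then have "openin \<tau> {x. \<phi> x = 1}"
      using dual dual_group_kernel_openin[OF m gt] by blast
    then obtain n where "V n \<subseteq> {x. \<phi> x = 1}"
      using V(3) character_0[OF \<phi>(1)] by blast
    then show False using \<phi>(3)[of n] by blast
  qed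
  moreover have "precompact \<tau> \<and> mackey \<tau>" if small: "dual_group \<tau> \<prec> (UNIV :: real set)"
  proof -
    \<comment> \<open>Otherwise the constant sequence \<open>UNIV\<close> yields an injection of the
      power set of the naturals into the dual group, against its size.\<close>
    have cover: "finitely_covered H UNIV" if H: "add_subgroup H"
      and dual: "\<And>\<phi>. character \<phi> \<Longrightarrow> (\<And>h. h \<in> H \<Longrightarrow> \<phi> h = 1) \<Longrightarrow> \<phi> \<in> dual_group \<tau>"
    for H :: "'a set"
    proof (rule ccontr)
      assume "\<not> finitely_covered H UNIV"
      then obtain \<Phi> :: "nat set \<Rightarrow> 'a \<Rightarrow> complex" where "inj \<Phi>"
        "\<And>s. character (\<Phi> s)" "\<And>s h. h \<in> H \<Longrightarrow> \<Phi> s h = 1"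
        using many_characters[OF m H, of "\<lambda>_. UNIV"] by metis
      then have "(UNIV :: nat set set) \<lesssim> dual_group \<tau>"
        using dual unfolding lepoll_def by (metis image_subsetI)
      then have "(UNIV :: nat set set) \<prec> (UNIV :: real set)"
        using small lesspoll_trans1 by blast
      then show False using nat_sets_eqpoll_reals by (simp add: lesspoll_def)
    qed
    have "mackey \<tau>"
    proof (rule mackeyI[OF m assms(2)])
      fix H :: "'a set"
      assume "add_subgroup H"
        and "\<And>\<phi>. character \<phi> \<Longrightarrow> (\<And>h. h \<in> H \<Longrightarrow> \<phi> h = 1) \<Longrightarrow> \<phi> \<in> dual_group \<tau>"
      then have "finitely_covered H UNIV" by (rule cover)
      then show "\<exists>W. openin \<tau> W \<and> 0 \<in> W \<and> finitely_covered H W"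
        using openin_topspace[of \<tau>] top by auto
    qed
    moreover have "precompact \<tau>"
      unfolding precompact_def
    proof (intro conjI allI impI gt)
      fix U assume "\<exists>V. openin \<tau> V \<and> 0 \<in> V \<and> V \<subseteq> U"
      then obtain H where H: "add_subgroup H" "openin \<tau> H" "H \<subseteq> U"
        using locally_quasi_convex_linear[OF m assms(2)] by (metis order_trans)
      \<comment> \<open>Characters trivial on the open \<open>H\<close> are continuous, so
        \<open>cover\<close> gives \<open>H\<close> finite index; its coset representatives serve as
        \<open>F\<close>.\<close>
      have "0 \<in> H" using H(1) by (simp add: add_subgroup_def)
      then have "finitely_covered H UNIV"
        using cover[OF H(1)] dual_groupI[OF gt _ H(2)] by blast
      then obtain F where F: "finite F" "\<And>x. \<exists>e\<in>F. x - e \<in> H"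
        by (auto simp: finitely_covered_def)
      have "x \<in> {f + u |f u. f \<in> F \<and> u \<in> U}" for x
      proof -
        obtain e where "e \<in> F" "x - e \<in> U" using F(2) H(3) by blast
        moreover have "x = e + (x - e)" by simp
        ultimately show ?thesis by blast
      qed
      then show "\<exists>F. finite F \<and> {f + u |f u. f \<in> F \<and> u \<in> U} = UNIV" using F(1) by blast
    qed
    ultimately show ?thesis by blast
  qed
  ultimately show ?thesis by blast
qed

end
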